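(* Let $p \geq 7$ be a prime and let $G$ be a finite non-cyclic abelian group of order $p^n$ for some positive integer $n$. Then the proper power graph $P^\ast(G)$ is non-planar.
   Context: The power graph $P(G)$ of a group $G$ is the simple undirected graph with vertex set $G$ in which two distinct vertices $a,b$ are adjacent if and only if $a\in\langle b\rangle$ or $b\in\langle a\rangle$. The proper power graph $P^\ast(G)$ is the graph obtained from $P(G)$ by deleting the vertex corresponding to the identity element. A graph is planar if it can be drawn in the plane with no edges crossing; equivalently (Kuratowski), if it contains no subgraph that is a subdivision of $K_5$ or $K_{3,3}$. *)

theory Defs
  imports
    "HOL-Algebra.Elementary_Groups"
    "HOL-Computational_Algebra.Primes"
    "HOL-Analysis.Path_Connected"
    "Graph_Theory.Pair_Digraph"
begin

text \<open>
  As in \<^theory>\<open>Graph_Theory.Digraph\<close>, a simple undirected graph is represented by a loop-free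
  symmetric digraph without parallel arcs (locale \<^locale>\<open>graph\<close>): an edge between
  \<open>a\<close> and \<open>b\<close> is the pair of arcs \<open>(a, b)\<close>, \<open>(b, a)\<close>.
\<close>

definition power_graph :: "('a, 'b) monoid_scheme \<Rightarrow> 'a pair_pre_digraph" where
  "power_graph G =
     \<lparr> pverts = carrier G,
       parcs = {(a, b). a \<in> carrier G \<and> b \<in> carrier G \<and> a \<noteq> b \<and>
                        (a \<in> generate G {b} \<or> b \<in> generate G {a})} \<rparr>"

definition proper_power_graph :: "('a, 'b) monoid_scheme \<Rightarrow> ('a, 'a \<times> 'a) pre_digraph" where
  "proper_power_graph G = pre_digraph.del_vert (with_proj (power_graph G)) \<one>\<^bsub>G\<^esub>"

lemma graph_power_graph:
  assumes "finite (carrier G)"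
  shows "graph (with_proj (power_graph G))"
proof -
  have "finite (parcs (power_graph G))"
    by (rule finite_subset[of _ "carrier G \<times> carrier G"]) (auto simp: power_graph_def assms)
  then interpret pair_graph "power_graph G"
    using assms
    by unfold_locales (auto simp: power_graph_def symmetric_def intro!: symI)
  show ?thesis by unfold_locales
qed

lemma graph_proper_power_graph:
  assumes "finite (carrier G)"
  shows "graph (proper_power_graph G)"
proof -
  interpret P: graph "with_proj (power_graph G)" by (rule graph_power_graph[OF assms])
  have E: "arcs_ends (proper_power_graph G)
      = {(a, b) \<in> parcs (power_graph G). a \<noteq> \<one>\<^bsub>G\<^esub> \<and> b \<noteq> \<one>\<^bsub>G\<^esub>}"
    by (force simp: proper_power_graph_def pre_digraph.del_vert_simps arcs_ends_conv)
  interpret D: digraph "proper_power_graph G"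
    unfolding proper_power_graph_def
    using P.fin_digraph_del_vert P.no_loops P.no_multi_arcs
    by (auto simp: digraph_def loopfree_digraph_def loopfree_digraph_axioms_def
        nomulti_digraph_def nomulti_digraph_axioms_def fin_digraph_def
        pre_digraph.del_vert_simps arc_to_ends_def)
  show ?thesis
    by unfold_locales (auto simp: symmetric_def E power_graph_def intro!: symI)
qed

definition edges :: "('a, 'b) pre_digraph \<Rightarrow> 'a set set" where
  "edges G = {{u, v} | u v. (u, v) \<in> arcs_ends G}"

text \<open>
  A drawing without crossings in the plane, taken to be \<^typ>\<open>complex\<close>: \<open>\<phi>\<close> places the vertices
  at distinct points, and \<open>\<gamma>\<close> sends each edge to a Jordan arc joining the images of its two
  endpoints. Such an arc passes through no other vertex, and two different arcs meet only in
  the images of common endpoints.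
\<close>

definition plane_drawing ::
  "('a, 'b) pre_digraph \<Rightarrow> ('a \<Rightarrow> complex) \<Rightarrow> ('a set \<Rightarrow> real \<Rightarrow> complex) \<Rightarrow> bool" where
  "plane_drawing G \<phi> \<gamma> \<longleftrightarrow>
     inj_on \<phi> (verts G) \<and>
     (\<forall>e \<in> edges G. arc (\<gamma> e) \<and> {pathstart (\<gamma> e), pathfinish (\<gamma> e)} = \<phi> ` e \<and>
                    path_image (\<gamma> e) \<inter> \<phi> ` verts G = \<phi> ` e) \<and>
     (\<forall>e \<in> edges G. \<forall>e' \<in> edges G. e \<noteq> e' \<longrightarrow>
                    path_image (\<gamma> e) \<inter> path_image (\<gamma> e') = \<phi> ` (e \<inter> e'))"

definition planar :: "('a, 'b) pre_digraph \<Rightarrow> bool" where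
  "planar G \<longleftrightarrow> (\<exists>\<phi> \<gamma>. plane_drawing G \<phi> \<gamma>)"

end

theory Submission
  imports
    Defs
    "HOL-Algebra.Multiplicative_Group"
    "HOL-Analysis.Jordan_Curve"
begin

text \<open>
  A non-identity element \<open>x\<close> has order a positive power of \<open>p \<ge> 7\<close>, so \<open>x, x\<^sup>2, \<dots>, x\<^sup>6\<close> are distinct
  generators of the same cyclic subgroup. They span a \<open>K\<^sub>6\<close> in the proper power graph, hence a
  \<open>K\<^bsub>3,3\<^esub>\<close>. In a drawing of \<open>K\<^bsub>3,3\<^esub>\<close>, two vertices of one side and their three common neighbours
  form a theta curve, and the third vertex with its open edges is a connected set avoiding the
  theta curve whose closure meets the interiors of all three of its arcs. No such set exists, since
  each complementary component of a theta curve is bounded by only two of its arcs.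
\<close>

section \<open>Theta curves\<close>

text \<open>The Jordan curve theorem for the loop \<open>c1 +++ reversepath c2\<close>. The frontier
  of either side is the whole curve \<open>J\<close>, which gives both closures.\<close>

lemma Jordan_two_arcs:
  fixes c1 c2 :: "real \<Rightarrow> complex"
  assumes "arc c1" "pathstart c1 = a" "pathfinish c1 = b"
    and "arc c2" "pathstart c2 = a" "pathfinish c2 = b"
    and "path_image c1 \<inter> path_image c2 = {a, b}"
  defines "J \<equiv> path_image c1 \<union> path_image c2"
  shows "compact J" "inside J \<noteq> {}" "connected (inside J)" "connected (outside J)"
    "closure (inside J) = inside J \<union> J" "closure (outside J) = outside J \<union> J"
proof -
  have "simple_path (c1 +++ reversepath c2)"
    using assms by (intro simple_path_join_loop) (auto simp: arc_reversepath)
  moreover have "pathfinish (c1 +++ reversepath c2) = pathstart (c1 +++ reversepath c2)"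
    using assms by simp
  moreover have "path_image (c1 +++ reversepath c2) = J"
    using assms by (simp add: path_image_join)
  ultimately show "inside J \<noteq> {}" "connected (inside J)" "connected (outside J)"
      "closure (inside J) = inside J \<union> J" "closure (outside J) = outside J \<union> J"
    using Jordan_inside_outside[of "c1 +++ reversepath c2"]
    by (simp_all add: closure_Un_frontier)
  show "compact J"
    using assms by (simp add: compact_Un compact_path_image arc_imp_path)
qed

text \<open>\<open>inside T\<close> is a union of components of the complement of \<open>T\<close>,
  so a connected set that avoids \<open>T\<close> and enters it stays in it.\<close>

lemma connected_subset_inside_or_outside:
  assumes "connected S" "S \<inter> T = {}"
  shows "S \<subseteq> inside T \<or> S \<subseteq> outside T"
proof (cases "S \<inter> inside T = {}")
  case True
  then show ?thesis using inside_Un_outside[of T] assms(2) by blast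
next
  case False
  then obtain x where x: "x \<in> S" "x \<in> inside T" by blast
  have "y \<in> inside T" if "y \<in> S" for y
    using inside_same_component[of T x y] x assms that
    by (auto simp: connected_component_def)
  then show ?thesis by blast
qed

locale theta_curve =
  fixes c1 c2 c3 :: "real \<Rightarrow> complex" and a b :: complex
  assumes arcs: "arc c1" "arc c2" "arc c3"
    and starts: "pathstart c1 = a" "pathstart c2 = a" "pathstart c3 = a"
    and finishes: "pathfinish c1 = b" "pathfinish c2 = b" "pathfinish c3 = b"
    and meets: "path_image c1 \<inter> path_image c2 = {a, b}" "path_image c1 \<inter> path_image c3 = {a, b}"
      "path_image c2 \<inter> path_image c3 = {a, b}"
begin

abbreviation "P1 \<equiv> path_image c1"
abbreviation "P2 \<equiv> path_image c2"
abbreviation "P3 \<equiv> path_image c3"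

lemmas Jordan12 = Jordan_two_arcs[OF arcs(1) starts(1) finishes(1) arcs(2) starts(2) finishes(2) meets(1)]
lemmas Jordan13 = Jordan_two_arcs[OF arcs(1) starts(1) finishes(1) arcs(3) starts(3) finishes(3) meets(2)]
lemmas Jordan23 = Jordan_two_arcs[OF arcs(2) starts(2) finishes(2) arcs(3) starts(3) finishes(3) meets(3)]

lemma ends_distinct: "a \<noteq> b"
  using arc_distinct_ends[OF arcs(1)] starts finishes by simp

text \<open>Cyclic symmetry: what is shown for \<open>c3\<close> against the other two arcs
  transfers to \<open>c1\<close> and \<open>c2\<close>.\<close>

lemma rotate: "theta_curve c2 c3 c1 a b"
  using arcs starts finishes meets by unfold_locales auto

text \<open>Here \<open>P3\<close> is a chord of the disc bounded by \<open>P1 \<union> P2\<close>,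
  so the theta curve has three complementary regions, each bounded by two of the arcs.
  \<open>S\<close> lies in one of them, and its closure then misses the interior of the remaining
  arc.\<close>

lemma no_tripod_if_meets_inside:
  assumes in3: "P3 \<inter> inside (P1 \<union> P2) \<noteq> {}"
    and S: "connected S" "S \<inter> (P1 \<union> P2 \<union> P3) = {}"
    and y1: "y1 \<in> P1 - {a, b}" "y1 \<in> closure S"
    and y2: "y2 \<in> P2 - {a, b}" "y2 \<in> closure S"
    and y3: "y3 \<in> P3 - {a, b}" "y3 \<in> closure S"
  shows False
proof -
  have split: "inside (P1 \<union> P3) \<union> inside (P2 \<union> P3) \<union> (P3 - {a, b}) = inside (P1 \<union> P2)"
    by (rule split_inside_simple_closed_curve[of c1 a b c2 c3])
      (use arcs starts finishes meets ends_distinct in3 in \<open>auto intro: arc_imp_simple_path\<close>)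
  have ni: "inside (P1 \<union> P2) \<inter> (P1 \<union> P2) = {}" by simp
  have "S \<subseteq> inside (P1 \<union> P2) \<or> S \<subseteq> outside (P1 \<union> P2)"
    using connected_subset_inside_or_outside[OF S(1), of "P1 \<union> P2"] S(2) by blast
  \<comment> \<open>Inside \<open>P1 \<union> P2\<close>, the set \<open>S\<close> avoids the chord,
    and being connected it cannot meet both halves of the disc.\<close>
  then consider "S \<subseteq> outside (P1 \<union> P2)" | "S \<subseteq> inside (P1 \<union> P3)" | "S \<subseteq> inside (P2 \<union> P3)"
  proof (elim disjE)
    assume "S \<subseteq> inside (P1 \<union> P2)"
    then have "S \<subseteq> inside (P1 \<union> P3) \<union> inside (P2 \<union> P3)" using split S(2) by blast
    moreover have "S \<subseteq> inside (P1 \<union> P3) \<or> S \<subseteq> outside (P1 \<union> P3)"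
      using connected_subset_inside_or_outside[OF S(1), of "P1 \<union> P3"] S(2) by blast
    moreover have "inside (P1 \<union> P3) \<inter> outside (P1 \<union> P3) = {}" by simp
    ultimately show ?thesis using that by blast
  qed
  then show False
  proof cases
    case 1
    then have "y3 \<in> outside (P1 \<union> P2) \<union> (P1 \<union> P2)"
      using closure_mono[OF 1] y3(2) Jordan12(6) by blast
    moreover have "y3 \<in> inside (P1 \<union> P2)" using split y3(1) by blast
    moreover have "inside (P1 \<union> P2) \<inter> outside (P1 \<union> P2) = {}" by simp
    ultimately show False using ni by blast
  next
    case 2
    then have "y2 \<in> inside (P1 \<union> P3) \<union> (P1 \<union> P3)"
      using closure_mono[OF 2] y2(2) Jordan13(5) by blast
    then show False using split ni y2(1) meets by blast
  next
    case 3
    then have "y1 \<in> inside (P2 \<union> P3) \<union> (P2 \<union> P3)"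
      using closure_mono[OF 3] y1(2) Jordan23(5) by blast
    then show False using split ni y1(1) meets by blast
  qed
qed

text \<open>
  If all three arcs lay outside the respective opposite Jordan curves, Janiszewski's theorem would
  join the inside of \<open>P2 \<union> P3\<close> to the common outside without crossing the theta curve.
\<close>

lemma some_arc_meets_inside:
  assumes y3: "y3 \<in> P3 - {a, b}"
    and s: "s \<in> outside (P1 \<union> P2)" "s \<in> outside (P1 \<union> P3)" "s \<in> outside (P2 \<union> P3)"
  shows "P1 \<inter> inside (P2 \<union> P3) \<noteq> {} \<or> P2 \<inter> inside (P1 \<union> P3) \<noteq> {} \<or> P3 \<inter> inside (P1 \<union> P2) \<noteq> {}"
proof (rule ccontr)
  assume "\<not> ?thesis"
  then have n1: "P1 \<inter> inside (P2 \<union> P3) = {}" and n2: "P2 \<inter> inside (P1 \<union> P3) = {}"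
    and n3: "P3 \<inter> inside (P1 \<union> P2) = {}" by auto
  have y2: "P2 - {a, b} \<noteq> {}"
    using nonempty_simple_path_endless[of c2] arcs starts finishes arc_imp_simple_path by metis
  have ni: "inside (P2 \<union> P3) \<inter> (P2 \<union> P3) = {}" by simp
  have o12: "inside (P2 \<union> P3) \<subseteq> outside (P1 \<union> P2)"
  proof -
    \<comment> \<open>Otherwise closures put \<open>y3\<close> inside or on
      \<open>P1 \<union> P2\<close>; the former contradicts \<open>n3\<close>, the latter
      \<open>meets\<close>.\<close>
    have "\<not> inside (P2 \<union> P3) \<subseteq> inside (P1 \<union> P2)"
    proof
      assume "inside (P2 \<union> P3) \<subseteq> inside (P1 \<union> P2)"
      from closure_mono[OF this] have "y3 \<in> inside (P1 \<union> P2) \<union> (P1 \<union> P2)"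
        using Jordan23(5) Jordan12(5) y3 by blast
      then show False using n3 y3 meets by blast
    qed
    then show ?thesis
      using connected_subset_inside_or_outside[OF Jordan23(3), of "P1 \<union> P2"] n1 ni by blast
  qed
  have o13: "inside (P2 \<union> P3) \<subseteq> outside (P1 \<union> P3)"
  proof -
    have "\<not> inside (P2 \<union> P3) \<subseteq> inside (P1 \<union> P3)"
    proof
      assume "inside (P2 \<union> P3) \<subseteq> inside (P1 \<union> P3)"
      from closure_mono[OF this] have "P2 \<subseteq> inside (P1 \<union> P3) \<union> (P1 \<union> P3)"
        using Jordan23(5) Jordan13(5) by blast
      then show False using n2 y2 meets by blast
    qed
    then show ?thesis
      using connected_subset_inside_or_outside[OF Jordan23(3), of "P1 \<union> P3"] n1 ni by blast
  qed
  obtain d where d: "d \<in> inside (P2 \<union> P3)" using Jordan23(2) by blast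
  have sub: "outside T \<subseteq> - T" for T :: "complex set" using inside_Un_outside by blast
  \<comment> \<open>Neither closed curve separates \<open>d\<close> from \<open>s\<close>, and the
    two curves meet in the connected set \<open>P1\<close>, so their union does not separate these
    points either.\<close>
  have "connected_component (- ((P1 \<union> P2) \<union> (P1 \<union> P3))) d s"
  proof (rule Janiszewski)
    have "(P1 \<union> P2) \<inter> (P1 \<union> P3) = P1" using meets by blast
    then show "connected ((P1 \<union> P2) \<inter> (P1 \<union> P3))"
      using arcs by (simp add: connected_path_image arc_imp_path)
    show "connected_component (- (P1 \<union> P2)) d s"
      using Jordan12(4) d s o12 sub unfolding connected_component_def by blast
    show "connected_component (- (P1 \<union> P3)) d s"
      using Jordan13(4) d s o13 sub unfolding connected_component_def by blast
  qed (use Jordan12(1) Jordan13(1) in \<open>auto intro: compact_imp_closed\<close>)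
  \<comment> \<open>Forgetting \<open>P1\<close> puts \<open>s\<close> in the component of
    \<open>d\<close>, which is inside \<open>P2 \<union> P3\<close>, whereas \<open>s\<close> was
    chosen outside.\<close>
  then have "connected_component (- (P2 \<union> P3)) d s"
    by (rule connected_component_of_subset) auto
  then have "s \<in> inside (P2 \<union> P3)" using inside_same_component d by blast
  then show False using s(3) inside_Int_outside[of "P2 \<union> P3"] by blast
qed

text \<open>If some arc enters the inside of the curve formed by the other two, a rotation of the
  chord case applies. Otherwise closures force \<open>S\<close> outside all three Jordan curves, and
  any point of \<open>S\<close> contradicts \<open>some_arc_meets_inside\<close>.\<close>

theorem no_tripod:
  assumes S: "connected S" "S \<inter> (P1 \<union> P2 \<union> P3) = {}"
    and y1: "y1 \<in> P1 - {a, b}" "y1 \<in> closure S"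
    and y2: "y2 \<in> P2 - {a, b}" "y2 \<in> closure S"
    and y3: "y3 \<in> P3 - {a, b}" "y3 \<in> closure S"
  shows False
proof -
  interpret R: theta_curve c2 c3 c1 a b by (rule rotate)
  interpret RR: theta_curve c3 c1 c2 a b by (rule R.rotate)
  have S': "S \<inter> (P2 \<union> P3 \<union> P1) = {}" "S \<inter> (P3 \<union> P1 \<union> P2) = {}" using S(2) by auto
  have n: "P3 \<inter> inside (P1 \<union> P2) = {}" "P1 \<inter> inside (P2 \<union> P3) = {}"
    "P2 \<inter> inside (P1 \<union> P3) = {}"
    using no_tripod_if_meets_inside[OF _ S y1 y2 y3]
      R.no_tripod_if_meets_inside[OF _ S(1) S'(1) y2 y3 y1]
      RR.no_tripod_if_meets_inside[OF _ S(1) S'(2) y3 y1 y2]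
    by (auto simp: Un_commute)
  have "S \<subseteq> outside (P1 \<union> P2)"
  proof -
    have "\<not> S \<subseteq> inside (P1 \<union> P2)"
      using closure_mono[of S "inside (P1 \<union> P2)"] Jordan12(5) y3 n(1) meets by blast
    then show ?thesis
      using connected_subset_inside_or_outside[OF S(1), of "P1 \<union> P2"] S(2) by blast
  qed
  moreover have "S \<subseteq> outside (P2 \<union> P3)"
  proof -
    have "\<not> S \<subseteq> inside (P2 \<union> P3)"
      using closure_mono[of S "inside (P2 \<union> P3)"] Jordan23(5) y1 n(2) meets by blast
    then show ?thesis
      using connected_subset_inside_or_outside[OF S(1), of "P2 \<union> P3"] S(2) by blast
  qed
  moreover have "S \<subseteq> outside (P1 \<union> P3)"
  proof -
    have "\<not> S \<subseteq> inside (P1 \<union> P3)"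
      using closure_mono[of S "inside (P1 \<union> P3)"] Jordan13(5) y2 n(3) meets by blast
    then show ?thesis
      using connected_subset_inside_or_outside[OF S(1), of "P1 \<union> P3"] S(2) by blast
  qed
  moreover obtain s where "s \<in> S" using y1(2) by fastforce
  ultimately show False using some_arc_meets_inside[OF y3(1), of s] n by blast
qed

end

section \<open>The complete bipartite graph \<open>K\<^bsub>3,3\<^esub>\<close>\<close>

text \<open>A drawing fixes the ends of an edge only as an unordered pair; reversing the arc where
  necessary gives the orientation needed for joining paths.\<close>

lemma arc_with_ends:
  fixes g :: "real \<Rightarrow> 'a::topological_space"
  assumes "arc g" "{pathstart g, pathfinish g} = {u, v}" "u \<noteq> v"
  obtains h where "arc h" "pathstart h = u" "pathfinish h = v" "path_image h = path_image g"
proof (cases "pathstart g = u")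
  case True
  then show ?thesis using that[of g] assms by (metis doubleton_eq_iff)
next
  case False
  then show ?thesis using that[of "reversepath g"] assms
    by (auto simp: arc_reversepath doubleton_eq_iff)
qed

text \<open>The set is the image of the half-open interval \<open>{0..<1}\<close>, whose closure
  contains 1. It serves as a leg of the tripod with its foot removed.\<close>

lemma arc_minus_finish:
  fixes g :: "real \<Rightarrow> 'a::t2_space"
  assumes "arc g"
  shows "connected (path_image g - {pathfinish g})"
    and "pathfinish g \<in> closure (path_image g - {pathfinish g})"
proof -
  have g: "continuous_on {0..1} g" "inj_on g {0..1}"
    using assms by (auto simp: arc_def path_def)
  have eq: "path_image g - {pathfinish g} = g ` {0..<1}"
  proof -
    have "g ` ({0..1} - {1}) = g ` {0..1} - g ` {1}"
      using g(2) by (intro inj_on_image_set_diff) auto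
    moreover have "{0..1} - {1} = {0..<1::real}" by auto
    ultimately show ?thesis by (simp add: path_image_def pathfinish_def)
  qed
  show "connected (path_image g - {pathfinish g})"
    unfolding eq by (intro connected_continuous_image continuous_on_subset[OF g(1)]) auto
  have "g ` closure {0..<1} \<subseteq> closure (g ` {0..<1})"
    using g(1) by (intro image_closure_subset) (use closure_subset[of "g ` {0..<1}"] in auto)
  then show "pathfinish g \<in> closure (path_image g - {pathfinish g})"
    unfolding eq by (auto simp: pathfinish_def image_subset_iff)
qed

lemma not_planar_if_K33:
  assumes dist: "distinct [x1, x2, x3, y1, y2, y3]"
    and verts: "{x1, x2, x3, y1, y2, y3} \<subseteq> verts H"
    and adj: "\<And>x y. x \<in> {x1, x2, x3} \<Longrightarrow> y \<in> {y1, y2, y3} \<Longrightarrow> {x, y} \<in> edges H"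
  shows "\<not> planar H"
proof
  assume "planar H"
  then obtain \<phi> \<gamma> where "plane_drawing H \<phi> \<gamma>" by (auto simp: planar_def)
  then have inj: "inj_on \<phi> (verts H)"
    and arc: "\<And>e. e \<in> edges H \<Longrightarrow> arc (\<gamma> e)"
    and ends: "\<And>e. e \<in> edges H \<Longrightarrow> {pathstart (\<gamma> e), pathfinish (\<gamma> e)} = \<phi> ` e"
    and cross: "\<And>e e'. e \<in> edges H \<Longrightarrow> e' \<in> edges H \<Longrightarrow> e \<noteq> e' \<Longrightarrow>
      path_image (\<gamma> e) \<inter> path_image (\<gamma> e') = \<phi> ` (e \<inter> e')"
    by (auto simp: plane_drawing_def)
  define X where "X = {x1, x2, x3}"
  define Y where "Y = {y1, y2, y3}"
  have disj: "X \<inter> Y = {}" using dist by (auto simp: X_def Y_def)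
  have phi_eq: "\<phi> u = \<phi> v \<longleftrightarrow> u = v" if "u \<in> X \<union> Y" "v \<in> X \<union> Y" for u v
    using inj verts that by (auto simp: inj_on_def X_def Y_def)
  have "\<exists>h. arc h \<and> pathstart h = \<phi> x \<and> pathfinish h = \<phi> y \<and> path_image h = path_image (\<gamma> {x, y})"
    if "x \<in> X" "y \<in> Y" for x y
  proof -
    have e: "{x, y} \<in> edges H" using adj that by (auto simp: X_def Y_def)
    have "\<phi> x \<noteq> \<phi> y" using phi_eq[of x y] that disj by auto
    then show ?thesis
      using arc_with_ends[OF arc[OF e], of "\<phi> x" "\<phi> y"] ends[OF e]
      by (metis image_empty image_insert)
  qed
  then obtain h where h: "\<And>x y. x \<in> X \<Longrightarrow> y \<in> Y \<Longrightarrow> arc (h x y) \<and> pathstart (h x y) = \<phi> x \<and>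
      pathfinish (h x y) = \<phi> y \<and> path_image (h x y) = path_image (\<gamma> {x, y})"
    by metis
  define E where "E x y = path_image (h x y)" for x y
  have meet: "E x y \<inter> E x' y' = \<phi> ` ({x, y} \<inter> {x', y'})"
    if "x \<in> X" "y \<in> Y" "x' \<in> X" "y' \<in> Y" "(x, y) \<noteq> (x', y')" for x y x' y'
  proof -
    \<comment> \<open>The swapped match \<open>x = y'\<close>, \<open>y = x'\<close> is excluded
      because the two sides are disjoint.\<close>
    have "{x, y} \<noteq> {x', y'}" using that disj by (auto simp: doubleton_eq_iff)
    then show ?thesis
      using cross[of "{x, y}" "{x', y'}"] adj h that by (auto simp: E_def X_def Y_def)
  qed
  have meet_x: "E x y \<inter> E x y' = {\<phi> x}" if "x \<in> X" "y \<in> Y" "y' \<in> Y" "y \<noteq> y'" for x y y'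
  proof -
    have "{x, y} \<inter> {x, y'} = {x}" using that disj by auto
    then show ?thesis using meet[of x y x y'] that by simp
  qed
  have meet_y: "E x y \<inter> E x' y = {\<phi> y}" if "x \<in> X" "x' \<in> X" "y \<in> Y" "x \<noteq> x'" for x x' y
  proof -
    have "{x, y} \<inter> {x', y} = {y}" using that disj by auto
    then show ?thesis using meet[of x y x' y] that by simp
  qed
  have meet_none: "E x y \<inter> E x' y' = {}"
    if "x \<in> X" "x' \<in> X" "y \<in> Y" "y' \<in> Y" "x \<noteq> x'" "y \<noteq> y'" for x x' y y'
  proof -
    have "{x, y} \<inter> {x', y'} = {}" using that disj by auto
    then show ?thesis using meet[of x y x' y'] that by simp
  qed
  have phiE: "\<phi> x \<in> E x y" "\<phi> y \<in> E x y" if "x \<in> X" "y \<in> Y" for x y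
    using h[OF that] pathstart_in_path_image[of "h x y"] pathfinish_in_path_image[of "h x y"]
    by (auto simp: E_def)
  have X: "x1 \<in> X" "x2 \<in> X" "x3 \<in> X" "x1 \<noteq> x2" "x1 \<noteq> x3" "x2 \<noteq> x3"
    and Y: "y1 \<in> Y" "y2 \<in> Y" "y3 \<in> Y" "y1 \<noteq> y2" "y1 \<noteq> y3" "y2 \<noteq> y3"
    using dist by (auto simp: X_def Y_def)
  \<comment> \<open>The arc from \<open>\<phi> x1\<close> to \<open>\<phi> x2\<close> through
    \<open>\<phi> y\<close>; the three choices of \<open>y\<close> give the theta curve.\<close>
  define c where "c y = h x1 y +++ reversepath (h x2 y)" for y
  have c: "arc (c y)" "pathstart (c y) = \<phi> x1" "pathfinish (c y) = \<phi> x2"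
    "path_image (c y) = E x1 y \<union> E x2 y" if "y \<in> Y" for y
    using h[OF X(1) that] h[OF X(2) that] meet_y[OF X(1,2) that X(4)]
    by (auto simp: c_def E_def path_image_join arc_reversepath intro!: arc_join)
  have cc: "path_image (c y) \<inter> path_image (c y') = {\<phi> x1, \<phi> x2}"
    if "y \<in> Y" "y' \<in> Y" "y \<noteq> y'" for y y'
    using meet_x[OF X(1) that] meet_x[OF X(2) that]
      meet_none[OF X(1,2) that(1,2) X(4) that(3)] meet_none[OF X(2,1) that(1,2) X(4)[symmetric] that(3)]
    unfolding c(4)[OF that(1)] c(4)[OF that(2)] by blast
  interpret theta_curve "c y1" "c y2" "c y3" "\<phi> x1" "\<phi> x2"
    using c cc Y by unfold_locales auto
  \<comment> \<open>The tripod centred at \<open>\<phi> x3\<close>, without its feet, which lie on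
    the theta curve.\<close>
  define S where "S = (\<Union>y\<in>Y. E x3 y - {\<phi> y})"
  have cn: "connected (E x3 y - {\<phi> y})" "\<phi> y \<in> closure (E x3 y - {\<phi> y})" if "y \<in> Y" for y
    using arc_minus_finish[of "h x3 y"] h[OF X(3) that] by (auto simp: E_def)
  have "connected S"
    unfolding S_def
  proof (rule connected_Union)
    have "\<phi> x3 \<in> E x3 y - {\<phi> y}" if "y \<in> Y" for y
      using phiE(1)[OF X(3) that] phi_eq[of x3 y] X(3) that disj by auto
    then show "(\<Inter>y\<in>Y. E x3 y - {\<phi> y}) \<noteq> {}" by blast
  qed (use cn in auto)
  moreover have "S \<inter> path_image (c y) = {}" if "y \<in> Y" for y
  proof -
    \<comment> \<open>For \<open>z = y\<close> the only common point is the removed foot; for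
      \<open>z \<noteq> y\<close> the edges share no endpoint.\<close>
    have "(E x3 z - {\<phi> z}) \<inter> E x y = {}" if "z \<in> Y" "x \<in> {x1, x2}" for x z
      using that \<open>y \<in> Y\<close> X meet_y[of x3 x z] meet_none[of x3 x z y] by (cases "z = y") auto
    then show ?thesis unfolding S_def c(4)[OF that] by blast
  qed
  moreover have "\<phi> y \<in> closure S" if "y \<in> Y" for y
    using cn(2)[OF that] closure_mono[of "E x3 y - {\<phi> y}" S] that by (auto simp: S_def)
  moreover have "\<phi> y \<in> path_image (c y) - {\<phi> x1, \<phi> x2}" if "y \<in> Y" for y
    using phiE(2)[OF X(1) that] c(4)[OF that] phi_eq[of y] X that disj by auto
  ultimately show False
    using no_tripod[of S "\<phi> y1" "\<phi> y2" "\<phi> y3"] Y by (simp add: Int_Un_distrib)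
qed

section \<open>The proper power graph\<close>

lemma verts_proper_power_graph: "verts (proper_power_graph G) = carrier G - {\<one>\<^bsub>G\<^esub>}"
  by (simp add: proper_power_graph_def pre_digraph.del_vert_simps power_graph_def)

lemma edge_proper_power_graph:
  assumes "u \<in> carrier G" "v \<in> carrier G" "u \<noteq> \<one>\<^bsub>G\<^esub>" "v \<noteq> \<one>\<^bsub>G\<^esub>" "u \<noteq> v" "u \<in> generate G {v}"
  shows "{u, v} \<in> edges (proper_power_graph G)"
proof -
  have "(u, v) \<in> arcs_ends (proper_power_graph G)"
    using assms
    by (force simp: proper_power_graph_def pre_digraph.del_vert_simps arcs_ends_conv power_graph_def)
  then show ?thesis by (auto simp: edges_def)
qed

text \<open>By Bezout \<open>k\<close> is invertible modulo \<open>ord x\<close>, so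
  \<open>x\<close> itself is a power of \<open>x [^] k\<close>.\<close>

lemma (in group) mem_generate_coprime_pow:
  assumes x: "x \<in> carrier G" and "coprime k (ord x)"
  shows "x [^] (i::nat) \<in> generate G {x [^] (k::nat)}"
proof -
  have "\<exists>m::nat. x = (x [^] k) [^] m"
  \<comment> \<open>Treated apart because the Bezout identity over the naturals has no solution for
    \<open>k = 0\<close>, which is coprime to 1.\<close>
  proof (cases "ord x = 1")
    case True
    then have "x = (x [^] k) [^] (0::nat)" using ord_eq_1[OF x] by simp
    then show ?thesis ..
  next
    case False
    then obtain m l where "k * m = ord x * l + 1"
      using coprime_bezout_strong[of k "ord x"] assms(2) by blast
    then have "(x [^] k) [^] m = (x [^] ord x) [^] l \<otimes> x"
      using x by (metis nat_pow_pow nat_pow_mult nat_pow_eone)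
    then show ?thesis using x by (intro exI[of _ m]) simp
  qed
  then obtain m :: nat where "x = (x [^] k) [^] m" ..
  then have "x [^] i = (x [^] k) [^] (m * i)" using x by (metis nat_pow_pow nat_pow_closed)
  then have "x [^] i = (x [^] k) [^] int (m * i)" by (metis int_pow_int)
  then show ?thesis using generate_pow[of "x [^] k"] x by blast
qed

theorem theorem4p4:
  fixes G :: "('a, 'b) monoid_scheme" and p n :: nat
  assumes "prime p" and "p \<ge> 7"
    and "comm_group G" and "finite (carrier G)"
    and "\<not> cyclic_group G"
    and "n \<ge> 1" and "order G = p ^ n"
  shows "\<not> planar (proper_power_graph G)"
proof -
  interpret comm_group G by fact
  have "order G \<noteq> 1"
    using assms(1,6,7) by (simp add: prime_nat_iff)
  then obtain x where x: "x \<in> carrier G" "x \<noteq> \<one>\<^bsub>G\<^esub>"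
    by (metis one_closed order_def is_singletonI' is_singleton_altdef empty_iff)
  obtain k where k: "ord x = p ^ k"
    using ord_dvd_group_order[OF x(1)] assms(1,7) divides_primepow_nat[of p "ord x" n] by auto
  have "k \<noteq> 0" using k x ord_eq_1[of x] by (metis power_0)
  then have "p dvd ord x" using k by simp
  \<comment> \<open>The order being at least 7, the exponents 0 to 6 are all below it and give
    distinct powers.\<close>
  then have ord7: "7 \<le> ord x"
    using ord_ge_1[OF assms(4) x(1)] dvd_imp_le[of p "ord x"] assms(2) by linarith
  have cop: "coprime i (ord x)" if "i \<in> {1..6}" for i
  proof -
    have "\<not> p dvd i" using that assms(2) by (auto dest: dvd_imp_le)
    then show ?thesis
      using prime_imp_coprime[OF assms(1)] k by (simp add: coprime_commute)
  qed
  \<comment> \<open>Exponent 0 is included so that the powers used as vertices also differ from the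
    identity.\<close>
  have inj: "x [^]\<^bsub>G\<^esub> i = x [^]\<^bsub>G\<^esub> j \<longleftrightarrow> i = j" if "i \<le> 6" "j \<le> 6" for i j :: nat
    using inj_onD[OF ord_inj[OF x(1)], of i j] that ord7 by auto
  have ne1: "x [^]\<^bsub>G\<^esub> i \<noteq> \<one>\<^bsub>G\<^esub>" if "i \<in> {1..6}" for i :: nat
    using inj[of i 0] that by simp
  have adj: "{x [^]\<^bsub>G\<^esub> i, x [^]\<^bsub>G\<^esub> j} \<in> edges (proper_power_graph G)"
    if "i \<in> {1..6}" "j \<in> {1..6}" "i \<noteq> j" for i j :: nat
    using that x inj ne1 mem_generate_coprime_pow[OF x(1) cop]
    by (intro edge_proper_power_graph) auto
  show ?thesis
  proof (rule not_planar_if_K33[of "x [^]\<^bsub>G\<^esub> (1::nat)" "x [^]\<^bsub>G\<^esub> (2::nat)" "x [^]\<^bsub>G\<^esub> (3::nat)"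
        "x [^]\<^bsub>G\<^esub> (4::nat)" "x [^]\<^bsub>G\<^esub> (5::nat)" "x [^]\<^bsub>G\<^esub> (6::nat)"])
    show "distinct [x [^]\<^bsub>G\<^esub> (1::nat), x [^]\<^bsub>G\<^esub> (2::nat), x [^]\<^bsub>G\<^esub> (3::nat),
        x [^]\<^bsub>G\<^esub> (4::nat), x [^]\<^bsub>G\<^esub> (5::nat), x [^]\<^bsub>G\<^esub> (6::nat)]"
      by (simp add: inj del: nat_pow_eone nat_pow_Suc One_nat_def)
    show "{x [^]\<^bsub>G\<^esub> (1::nat), x [^]\<^bsub>G\<^esub> (2::nat), x [^]\<^bsub>G\<^esub> (3::nat),
        x [^]\<^bsub>G\<^esub> (4::nat), x [^]\<^bsub>G\<^esub> (5::nat), x [^]\<^bsub>G\<^esub> (6::nat)} \<subseteq> verts (proper_power_graph G)"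
      using x ne1 by (simp add: verts_proper_power_graph del: nat_pow_eone One_nat_def)
  qed (use adj in \<open>auto simp del: nat_pow_eone nat_pow_Suc One_nat_def\<close>)
qed

end
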